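(* Let $n \geq 3$ and let $S$ be a number. Then there exists $A \in A_n$ with $S = S(A^{-1})$ if and only if $S$ is an integer satisfying $$2-F_{n-1} \leq S \leq 2+F_{n-1}.$$
   Context: The Fibonacci numbers are $F_1=F_2=1$ and $F_k=F_{k-1}+F_{k-2}$ for $k\ge 3$. For a real matrix $X$, $S(X)$ denotes the sum of all entries of $X$. $A_n$ denotes the set of $n\times n$ invertible upper triangular matrices all of whose entries are in $\{0,1\}$ (so every diagonal entry equals $1$); inverses are taken over the real numbers. *)

theory Defs
  imports "Jordan_Normal_Form.Gauss_Jordan_Elimination" "HOL-Number_Theory.Fib"
begin

definition entry_sum :: "'a :: comm_monoid_add mat \<Rightarrow> 'a" where
  "entry_sum X = (\<Sum>i<dim_row X. \<Sum>j<dim_col X. X $$ (i, j))"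

definition upper_triangular_01 :: "nat \<Rightarrow> real mat set" where
  "upper_triangular_01 n =
     {A \<in> carrier_mat n n. invertible_mat A \<and> upper_triangular A \<and> elements_mat A \<subseteq> {0, 1}}"

(* Only meaningful for invertible square A; the two equations force the inverse to be square
   of the same size as A. *)
definition mat_inv :: "'a :: field mat \<Rightarrow> 'a mat" where
  "mat_inv A = (THE B. inverts_mat A B \<and> inverts_mat B A)"

lemma mat_inv_eqI:
  assumes "A \<in> carrier_mat n n" "inverts_mat A B" "inverts_mat B A"
  shows "B \<in> carrier_mat n n" "mat_inv A = B"
proof -
  have carrier: "C \<in> carrier_mat n n" if "inverts_mat A C" "inverts_mat C A" for C
  proof -
    have "dim_col (A * C) = n" "dim_col (C * A) = dim_row C"
      using that assms(1) by (simp_all add: inverts_mat_def)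
    then show ?thesis using assms(1) by auto
  qed
  show B: "B \<in> carrier_mat n n" using carrier assms by blast
  have "C = B" if C: "inverts_mat A C" "inverts_mat C A" for C
  proof -
    have Cn: "C \<in> carrier_mat n n" using carrier C by blast
    have "C = C * (A * B)" using assms(1,2) Cn by (simp add: inverts_mat_def)
    also have "\<dots> = (C * A) * B" using assms(1) B Cn by (simp add: assoc_mult_mat)
    also have "\<dots> = B" using C(2) B Cn by (simp add: inverts_mat_def)
    finally show ?thesis .
  qed
  then show "mat_inv A = B" unfolding mat_inv_def using assms(2,3) by blast
qed

lemma mat_inv_inverts:
  assumes "A \<in> carrier_mat n n" "invertible_mat A"
  shows "mat_inv A \<in> carrier_mat n n" "inverts_mat A (mat_inv A)" "inverts_mat (mat_inv A) A"
  using assms mat_inv_eqI[OF assms(1)] unfolding invertible_mat_def by metis+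

end

theory Submission
  imports Defs "Jordan_Normal_Form.Determinant"
begin

text \<open>Let \<open>v = A\<^sup>-\<^sup>1 1\<close>, so that the entry sum is \<open>\<Sum>v\<close>. Read from the last coordinate
  upwards, back substitution says that each coordinate is 1 minus an arbitrary subset sum of the
  previous ones. Let \<open>p + 1\<close> and \<open>q - 1\<close> be the sums of the positive parts and of the negative
  parts of the coordinates found so far; then the entry sum is \<open>2 + p - q\<close>. The subset sums of an
  admissible sequence fill the whole integer interval from \<open>1 - q\<close> to \<open>p + 1\<close>, so the next
  coordinate is an arbitrary integer in \<open>[-p, q]\<close>: a step adds at most \<open>q\<close> to \<open>p\<close> or at most \<open>p\<close>
  to \<open>q\<close>. Hence \<open>p\<close> and \<open>q\<close> grow at most like Fibonacci numbers, alternating the two kinds of step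
  attains this growth, and the last step realises every value of \<open>p - q\<close> in between.\<close>

section \<open>Admissible sequences and Fibonacci bounds on their signed parts\<close>

definition admissible :: "nat \<Rightarrow> (nat \<Rightarrow> 'a::ring_1) \<Rightarrow> bool" where
  "admissible n y \<longleftrightarrow> (\<forall>k<n. \<exists>T\<subseteq>{..<k}. y k = 1 - sum y T)"

text \<open>This is \<open>p + 1\<close> in the notation above, and \<open>neg_sum\<close> is
  \<open>q - 1\<close>.\<close>

definition pos_sum :: "nat \<Rightarrow> (nat \<Rightarrow> 'a::linordered_idom) \<Rightarrow> 'a" where
  "pos_sum n y = (\<Sum>k<n. max 0 (y k))"

definition neg_sum :: "nat \<Rightarrow> (nat \<Rightarrow> 'a::linordered_idom) \<Rightarrow> 'a" where
  "neg_sum n y = (\<Sum>k<n. max 0 (- y k))"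

lemma pos_sum_simps [simp]: "pos_sum 0 y = 0" "pos_sum (Suc n) y = pos_sum n y + max 0 (y n)"
  by (simp_all add: pos_sum_def)

lemma neg_sum_simps [simp]: "neg_sum 0 y = 0" "neg_sum (Suc n) y = neg_sum n y + max 0 (- y n)"
  by (simp_all add: neg_sum_def)

lemma pos_sum_nonneg: "0 \<le> pos_sum n y"
  by (simp add: pos_sum_def sum_nonneg)

lemma neg_sum_nonneg: "0 \<le> neg_sum n y"
  by (simp add: neg_sum_def sum_nonneg)

lemma sum_eq_pos_sum_minus_neg_sum: "sum y {..<n} = pos_sum n y - neg_sum n y"
  by (induction n) (auto simp: max_def)

lemma subset_sum_bounds:
  fixes y :: "nat \<Rightarrow> 'a::linordered_idom"
  assumes "T \<subseteq> {..<n}"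
  shows "- neg_sum n y \<le> sum y T" "sum y T \<le> pos_sum n y"
proof -
  have "sum y T \<le> (\<Sum>k\<in>T. max 0 (y k))" by (intro sum_mono) simp
  also have "\<dots> \<le> pos_sum n y" unfolding pos_sum_def using assms by (intro sum_mono2) auto
  finally show "sum y T \<le> pos_sum n y" .
  have "- sum y T \<le> (\<Sum>k\<in>T. max 0 (- y k))"
    unfolding sum_negf[symmetric] by (intro sum_mono) simp
  also have "\<dots> \<le> neg_sum n y" unfolding neg_sum_def using assms by (intro sum_mono2) auto
  finally show "- neg_sum n y \<le> sum y T" by linarith
qed

lemma admissible_Suc:
  "admissible (Suc n) y \<longleftrightarrow> admissible n y \<and> (\<exists>T\<subseteq>{..<n}. y n = 1 - sum y T)"
  unfolding admissible_def less_Suc_eq by blast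

lemma admissible_SucD:
  fixes y :: "nat \<Rightarrow> 'a::linordered_idom"
  assumes "admissible (Suc n) y"
  shows "admissible n y" "1 - pos_sum n y \<le> y n" "y n \<le> 1 + neg_sum n y"
proof -
  obtain T where "admissible n y" "T \<subseteq> {..<n}" "y n = 1 - sum y T"
    using assms by (auto simp: admissible_Suc)
  then show "admissible n y" "1 - pos_sum n y \<le> y n" "y n \<le> 1 + neg_sum n y"
    using subset_sum_bounds[of T n y] by simp_all
qed

text \<open>The bound on \<open>p + q\<close> is what closes the induction: a step leaves one of
  \<open>p\<close>, \<open>q\<close> fixed and raises the other to at most \<open>p + q\<close>, so
  the new total is at most the old total plus one old part, the sum of two consecutive Fibonacci
  numbers.\<close>

lemma admissible_fib_bounds:
  fixes y :: "nat \<Rightarrow> 'a::linordered_idom"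
  assumes "admissible (Suc n) y"
  shows "1 \<le> pos_sum (Suc n) y \<and> pos_sum (Suc n) y \<le> 1 + of_nat (fib (Suc n)) \<and>
    neg_sum (Suc n) y + 1 \<le> of_nat (fib (Suc n)) \<and>
    pos_sum (Suc n) y + neg_sum (Suc n) y \<le> of_nat (fib (Suc (Suc n)))"
  using assms
proof (induction n)
  case 0
  then show ?case by (auto simp: admissible_def)
next
  case (Suc n)
  \<comment> \<open>The last two facts give monotonicity, which covers the part left unchanged by
    the step.\<close>
  have f: "of_nat (fib (Suc (Suc (Suc n)))) = (of_nat (fib (Suc (Suc n))) + of_nat (fib (Suc n)) :: 'a)"
    "of_nat (fib (Suc (Suc n))) = (of_nat (fib (Suc n)) + of_nat (fib n) :: 'a)"
    "(of_nat (fib n) :: 'a) \<ge> 0"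
    by simp_all
  note y = admissible_SucD[OF Suc.prems]
  note IH = Suc.IH[OF y(1)]
  note N = neg_sum_nonneg[of "Suc n" y]
  show ?case
  proof (cases "y (Suc n) \<ge> 0")
    case True
    then have "pos_sum (Suc (Suc n)) y = pos_sum (Suc n) y + y (Suc n)"
      "neg_sum (Suc (Suc n)) y = neg_sum (Suc n) y" by simp_all
    then show ?thesis using f y(2,3) IH N True by linarith
  next
    case False
    then have "pos_sum (Suc (Suc n)) y = pos_sum (Suc n) y"
      "neg_sum (Suc (Suc n)) y = neg_sum (Suc n) y - y (Suc n)" by simp_all
    then show ?thesis using f y(2,3) IH N False by linarith
  qed
qed

text \<open>The bounds on the last term cancel one part: the total lies between
  \<open>1 - neg_sum\<close> and \<open>1 + pos_sum\<close>, both taken over the first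
  \<open>n - 1\<close> terms.\<close>

lemma admissible_sum_bounds:
  fixes y :: "nat \<Rightarrow> 'a::linordered_idom"
  assumes "admissible n y" "n \<ge> 2"
  shows "2 - of_nat (fib (n - 1)) \<le> sum y {..<n}" "sum y {..<n} \<le> 2 + of_nat (fib (n - 1))"
proof -
  obtain m where n: "n = Suc (Suc m)" using \<open>n \<ge> 2\<close> by (metis add_2_eq_Suc le_Suc_ex)
  note y = admissible_SucD[OF assms(1)[unfolded n]]
  note b = admissible_fib_bounds[OF y(1)]
  have s: "sum y {..<n} = pos_sum (Suc m) y - neg_sum (Suc m) y + y (Suc m)"
    unfolding n sum_eq_pos_sum_minus_neg_sum[symmetric] by simp
  show "2 - of_nat (fib (n - 1)) \<le> sum y {..<n}" "sum y {..<n} \<le> 2 + of_nat (fib (n - 1))"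
    unfolding s using n y(2,3) b by simp_all
qed

section \<open>Integrality and attained values\<close>

lemma admissible_Ints:
  assumes "admissible n y" "k < n"
  shows "y k \<in> \<int>"
  using assms(2)
proof (induction k rule: less_induct)
  case (less k)
  then obtain T where "T \<subseteq> {..<k}" "y k = 1 - sum y T"
    using assms(1) by (auto simp: admissible_def)
  with less show ?case by (auto intro!: Ints_diff Ints_sum)
qed

text \<open>Using index \<open>n\<close> or not gives the old interval and its translate by
  \<open>y n\<close>. As \<open>y n\<close> lies between \<open>1 - pos_sum n y\<close> and
  \<open>1 + neg_sum n y\<close>, no integer is missed between the two.\<close>

lemma admissible_subset_sums:
  fixes y :: "nat \<Rightarrow> int"
  assumes "admissible n y" "- neg_sum n y \<le> z" "z \<le> pos_sum n y"
  shows "\<exists>T\<subseteq>{..<n}. sum y T = z"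
  using assms
proof (induction n arbitrary: z)
  case 0
  then show ?case by auto
next
  case (Suc n)
  note y = admissible_SucD[OF Suc.prems(1)]
  note nonneg = pos_sum_nonneg[of n y] neg_sum_nonneg[of n y]
  show ?case
  proof (cases "- neg_sum n y \<le> z \<and> z \<le> pos_sum n y")
    case True
    with Suc.IH[OF y(1)] obtain T where "T \<subseteq> {..<n}" "sum y T = z" by blast
    then show ?thesis by (intro exI[of _ T]) auto
  next
    case False
    then have "- neg_sum n y \<le> z - y n" "z - y n \<le> pos_sum n y"
      using Suc.prems(2,3) y(2,3) nonneg by (auto simp: max_def split: if_splits)
    with Suc.IH[OF y(1)] obtain T where T: "T \<subseteq> {..<n}" "sum y T = z - y n" by blast
    moreover from T have "finite T" "n \<notin> T" by (auto intro: finite_subset)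
    ultimately show ?thesis by (intro exI[of _ "insert n T"]) auto
  qed
qed

text \<open>Converse over the integers of the bounds in \<open>admissible_SucD\<close>: for such
  \<open>t\<close>, the value \<open>1 - t\<close> lies in the interval filled by subset
  sums.\<close>

lemma admissible_extend:
  fixes y :: "nat \<Rightarrow> int"
  assumes "admissible n y" "1 - pos_sum n y \<le> t" "t \<le> 1 + neg_sum n y"
  obtains z where "admissible (Suc n) z" "z n = t"
    "pos_sum n z = pos_sum n y" "neg_sum n z = neg_sum n y"
proof
  let ?z = "y(n := t)"
  have sum_z: "sum ?z T = sum y T" if "T \<subseteq> {..<k}" "k \<le> n" for T k
    using that by (intro sum.cong) auto
  obtain T where T: "T \<subseteq> {..<n}" "sum y T = 1 - t"
    using admissible_subset_sums[OF assms(1), of "1 - t"] assms(2,3) by auto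
  have "admissible n ?z"
    unfolding admissible_def
  proof (intro allI impI)
    fix k assume k: "k < n"
    then obtain T where "T \<subseteq> {..<k}" "y k = 1 - sum y T"
      using assms(1) by (auto simp: admissible_def)
    then show "\<exists>T\<subseteq>{..<k}. ?z k = 1 - sum ?z T"
      using sum_z[of T k] k by (intro exI[of _ T]) simp
  qed
  then show "admissible (Suc n) ?z"
    using T sum_z[of T n] by (auto simp: admissible_Suc intro!: exI[of _ T])
  show "?z n = t" by simp
  show "pos_sum n ?z = pos_sum n y" "neg_sum n ?z = neg_sum n y"
    unfolding pos_sum_def neg_sum_def by (auto intro: sum.cong)
qed

text \<open>The two extremal states have \<open>(p, q)\<close> equal to consecutive Fibonacci
  numbers in either order. They coincide at \<open>n = 2\<close>, and each yields the other one at
  \<open>n + 1\<close>.\<close>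

lemma admissible_fib_attained:
  assumes "n \<ge> 2"
  shows "(\<exists>y. admissible n y \<and> pos_sum n y = 1 + int (fib n) \<and> neg_sum n y = int (fib (n - 1)) - 1) \<and>
    (\<exists>y. admissible n y \<and> pos_sum n y = 1 + int (fib (n - 1)) \<and> neg_sum n y = int (fib n) - 1)"
  using assms
proof (induction n rule: dec_induct)
  case base
  have "admissible 2 (\<lambda>_. 1 :: int)"
    by (auto simp: admissible_def)
  then show ?case
    by (intro conjI exI[of _ "\<lambda>_. 1"]) (simp_all add: numeral_2_eq_2)
next
  case (step n)
  have f: "fib (Suc n) = fib n + fib (n - 1)"
    using step.hyps by (cases n) auto
  from step.IH obtain y y' where
    y: "admissible n y" "pos_sum n y = 1 + int (fib n)" "neg_sum n y = int (fib (n - 1)) - 1" and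
    y': "admissible n y'" "pos_sum n y' = 1 + int (fib (n - 1))" "neg_sum n y' = int (fib n) - 1"
    by blast
  \<comment> \<open>The least admissible term \<open>-p\<close> raises \<open>q\<close> to
    \<open>p + q\<close>; below, the greatest term \<open>q\<close> raises \<open>p\<close>
    likewise.\<close>
  obtain z where "admissible (Suc n) z" "z n = - int (fib n)"
    "pos_sum n z = pos_sum n y" "neg_sum n z = neg_sum n y"
    by (rule admissible_extend[OF y(1), of "- int (fib n)"]) (use y in auto)
  moreover obtain z' where "admissible (Suc n) z'" "z' n = int (fib n)"
    "pos_sum n z' = pos_sum n y'" "neg_sum n z' = neg_sum n y'"
    by (rule admissible_extend[OF y'(1), of "int (fib n)"]) (use y' in auto)
  ultimately show ?case
    using y y' f by (intro conjI exI[of _ z] exI[of _ z']) simp_all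
qed

lemma admissible_sum_attained:
  fixes s :: int
  assumes "n \<ge> 3" "2 - int (fib (n - 1)) \<le> s" "s \<le> 2 + int (fib (n - 1))"
  obtains y where "admissible n y" "sum y {..<n} = s"
proof -
  obtain m where n: "n = Suc m" "m \<ge> 2"
    using assms(1) by (cases n) auto
  have m: "fib m > 0" "fib (m - 1) > 0" using n(2) by (simp_all add: fib_neq_0_nat)
  from admissible_fib_attained[OF n(2)] obtain y y' where
    y: "admissible m y" "pos_sum m y = 1 + int (fib m)" "neg_sum m y = int (fib (m - 1)) - 1" and
    y': "admissible m y'" "pos_sum m y' = 1 + int (fib (m - 1))" "neg_sum m y' = int (fib m) - 1"
    by blast
  \<comment> \<open>A last term \<open>s - pos_sum m y + neg_sum m y\<close> makes the total
    \<open>s\<close>; these inequalities say exactly that it is allowed. The two extremal states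
    cover the values from 2 upwards and those below 2.\<close>
  have "\<exists>y. admissible m y \<and> - neg_sum m y \<le> s - 1 \<and> s - 1 \<le> pos_sum m y"
  proof (cases "s \<ge> 2")
    case True
    then show ?thesis
      using y m assms(3) n(1) by (intro exI[of _ y]) simp
  next
    case False
    then show ?thesis
      using y' m assms(2) n(1) by (intro exI[of _ y']) simp
  qed
  then obtain y where y: "admissible m y" "- neg_sum m y \<le> s - 1" "s - 1 \<le> pos_sum m y"
    by blast
  obtain z where z: "admissible (Suc m) z" "z m = s - pos_sum m y + neg_sum m y"
    "pos_sum m z = pos_sum m y" "neg_sum m z = neg_sum m y"
    by (rule admissible_extend[OF y(1), of "s - pos_sum m y + neg_sum m y"]) (use y in auto)
  have "sum z {..<n} = s"
    using z unfolding n(1) by (simp add: sum_eq_pos_sum_minus_neg_sum)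
  with z n(1) that show ?thesis by blast
qed

section \<open>Translation between matrices and admissible sequences\<close>

text \<open>The coordinates of \<open>v\<close> are the row sums of the inverse.\<close>

lemma entry_sum_mat_inv:
  fixes A :: "'a::field mat"
  assumes A: "A \<in> carrier_mat n n" "invertible_mat A"
    and v: "v \<in> carrier_vec n" "A *\<^sub>v v = vec n (\<lambda>_. 1)"
  shows "entry_sum (mat_inv A) = (\<Sum>i<n. v $ i)"
proof -
  note B = mat_inv_inverts[OF A]
  have "v = mat_inv A *\<^sub>v vec n (\<lambda>_. 1)"
    using A B v by (simp flip: v(2) assoc_mult_mat_vec[OF B(1) A(1) v(1)] add: inverts_mat_def)
  then have "v $ i = (\<Sum>j<n. mat_inv A $$ (i, j))" if "i < n" for i
    using that B(1) by (simp add: scalar_prod_def lessThan_atLeast0)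
  then show ?thesis
    using B(1) by (simp add: entry_sum_def)
qed

lemma invertible_mat_iff_det_nonzero:
  fixes A :: "'a::field mat"
  assumes A: "A \<in> carrier_mat n n"
  shows "invertible_mat A \<longleftrightarrow> det A \<noteq> 0"
proof
  assume "invertible_mat A"
  note B = mat_inv_inverts[OF A this]
  have "det A * det (mat_inv A) = det (A * mat_inv A)"
    by (rule det_mult[OF A B(1), symmetric])
  also have "\<dots> = 1"
    using A B(2) by (simp add: inverts_mat_def)
  finally show "det A \<noteq> 0" by auto
next
  assume "det A \<noteq> 0"
  \<comment> \<open>The argument \<open>()\<close> only fills the extension slot of the matrix ring
    record.\<close>
  from det_non_zero_imp_unit[OF A this, of "()"] obtain B
    where "B \<in> carrier_mat n n" "A * B = 1\<^sub>m n" "B * A = 1\<^sub>m n"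
    by (auto simp: Units_def ring_mat_def)
  with A show "invertible_mat A"
    by (auto simp: invertible_mat_def inverts_mat_def)
qed

text \<open>The determinant is the product of the diagonal, and a nonzero entry from
  \<open>{0, 1}\<close> is 1.\<close>

lemma upper_triangular_01_iff:
  "A \<in> upper_triangular_01 n \<longleftrightarrow> A \<in> carrier_mat n n \<and> (\<forall>i<n. A $$ (i, i) = 1) \<and>
     (\<forall>i<n. \<forall>j<i. A $$ (i, j) = 0) \<and> (\<forall>i<n. \<forall>j<n. A $$ (i, j) \<in> {0, 1})"
proof (cases "A \<in> carrier_mat n n")
  case A: True
  have elements: "elements_mat A \<subseteq> {0, 1} \<longleftrightarrow> (\<forall>i<n. \<forall>j<n. A $$ (i, j) \<in> {0, 1})"
    using A unfolding elements_mat_def by fastforce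
  have triangular: "upper_triangular A \<longleftrightarrow> (\<forall>i<n. \<forall>j<i. A $$ (i, j) = 0)"
    using A by auto
  have "invertible_mat A \<longleftrightarrow> (\<forall>i<n. A $$ (i, i) \<noteq> 0)" if "upper_triangular A"
    using A by (auto simp: invertible_mat_iff_det_nonzero[OF A] det_upper_triangular[OF that A]
        diag_mat_def prod_list_zero_iff)
  moreover have "(\<forall>i<n. A $$ (i, i) \<noteq> 0) \<longleftrightarrow> (\<forall>i<n. A $$ (i, i) = 1)"
    if "\<forall>i<n. \<forall>j<n. A $$ (i, j) \<in> {0, 1}"
    using that by (metis insert_iff empty_iff zero_neq_one)
  ultimately show ?thesis
    unfolding upper_triangular_01_def mem_Collect_eq elements triangular by blast
qed (simp add: upper_triangular_01_def)

text \<open>Indices are reversed because back substitution starts at the last coordinate.\<close>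
lemma mult_mat_vec_upper_triangular_01:
  assumes A: "A \<in> upper_triangular_01 n" and v: "v \<in> carrier_vec n" and k: "k < n"
  shows "(A *\<^sub>v v) $ (n - Suc k) = v $ (n - Suc k) +
    (\<Sum>l | l < k \<and> A $$ (n - Suc k, n - Suc l) = 1. v $ (n - Suc l))"
proof -
  let ?i = "n - Suc k"
  note A = A[unfolded upper_triangular_01_iff]
  let ?g = "\<lambda>l. A $$ (?i, n - Suc l) * v $ (n - Suc l)"
  have "(A *\<^sub>v v) $ ?i = (\<Sum>j<n. A $$ (?i, j) * v $ j)"
    using A v k by (auto simp: scalar_prod_def lessThan_atLeast0)
  also have "\<dots> = sum ?g {..<n}"
    by (rule sum.nat_diff_reindex[symmetric])
  also have "\<dots> = sum ?g (insert k {l. l < k \<and> A $$ (?i, n - Suc l) = 1})"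
  proof (rule sum.mono_neutral_right)
    show "\<forall>l\<in>{..<n} - insert k {l. l < k \<and> A $$ (?i, n - Suc l) = 1}. ?g l = 0"
    proof
      fix l assume l: "l \<in> {..<n} - insert k {l. l < k \<and> A $$ (?i, n - Suc l) = 1}"
      show "?g l = 0"
      proof (cases "l < k")
        case True
        moreover have "A $$ (?i, n - Suc l) \<in> {0, 1}" using A k by simp
        ultimately show ?thesis using l by auto
      next
        case False
        with l k have "n - Suc l < ?i" "?i < n" by auto
        then show ?thesis using A by simp
      qed
    qed
  qed (use k in auto)
  also have "\<dots> = v $ ?i + (\<Sum>l | l < k \<and> A $$ (?i, n - Suc l) = 1. v $ (n - Suc l))"
    using A k by simp
  finally show ?thesis .
qed

text \<open>Each row of \<open>A *\<^sub>v v = 1\<close> is solved for its diagonal term; the ones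
  to the right of the diagonal form the index set \<open>T\<close>.\<close>

lemma entry_sum_mat_inv_admissible:
  assumes A: "A \<in> upper_triangular_01 n"
  obtains y where "admissible n y" "entry_sum (mat_inv A) = sum y {..<n}"
proof
  have A': "A \<in> carrier_mat n n" "invertible_mat A"
    using A by (auto simp: upper_triangular_01_def)
  note B = mat_inv_inverts[OF A']
  define v where "v = mat_inv A *\<^sub>v vec n (\<lambda>_. 1)"
  have v: "v \<in> carrier_vec n" using B(1) by (simp add: v_def)
  have Av: "A *\<^sub>v v = vec n (\<lambda>_. 1)"
    unfolding v_def using A' B
    by (simp flip: assoc_mult_mat_vec[OF A'(1) B(1) vec_carrier] add: inverts_mat_def)
  let ?y = "\<lambda>k. v $ (n - Suc k)"
  show "admissible n ?y"
    unfolding admissible_def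
  proof (intro allI impI)
    fix k assume k: "k < n"
    show "\<exists>T\<subseteq>{..<k}. ?y k = 1 - sum ?y T"
      using mult_mat_vec_upper_triangular_01[OF A v k] k
      by (intro exI[of _ "{l. l < k \<and> A $$ (n - Suc k, n - Suc l) = 1}"]) (auto simp: Av)
  qed
  show "entry_sum (mat_inv A) = sum ?y {..<n}"
    unfolding entry_sum_mat_inv[OF A' v Av] by (rule sum.nat_diff_reindex[symmetric])
qed

lemma admissible_entry_sum_mat_inv:
  assumes "admissible n y"
  obtains A where "A \<in> upper_triangular_01 n" "entry_sum (mat_inv A) = sum y {..<n}"
proof -
  obtain T where T: "\<And>k. k < n \<Longrightarrow> T k \<subseteq> {..<k} \<and> y k = 1 - sum y (T k)"
    using assms unfolding admissible_def by metis
  \<comment> \<open>Row \<open>n - Suc k\<close> carries its off-diagonal ones at the columns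
    \<open>n - Suc l\<close> with \<open>l\<close> in \<open>T k\<close>.\<close>
  define A :: "real mat" where
    "A = mat n n (\<lambda>(i, j). if i = j \<or> n - Suc j \<in> T (n - Suc i) then 1 else 0)"
  \<comment> \<open>For \<open>j < i\<close> the reversed index of \<open>j\<close> exceeds that of
    \<open>i\<close>, hence is outside \<open>T (n - Suc i)\<close>.\<close>
  have "A $$ (i, j) = 0" if "i < n" "j < i" for i j
    using T[of "n - Suc i"] that by (force simp: A_def)
  then have A: "A \<in> upper_triangular_01 n"
    by (auto simp: upper_triangular_01_iff A_def)
  then have A': "A \<in> carrier_mat n n" "invertible_mat A"
    by (auto simp: upper_triangular_01_def)
  define v where "v = vec n (\<lambda>i. y (n - Suc i))"
  have v: "v \<in> carrier_vec n" by (simp add: v_def)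
  have Av: "(A *\<^sub>v v) $ (n - Suc k) = 1" if k: "k < n" for k
  proof -
    have Tk: "{l. l < k \<and> A $$ (n - Suc k, n - Suc l) = 1} = T k"
      using T[OF k] k by (auto simp: A_def)
    have "(\<Sum>l\<in>T k. v $ (n - Suc l)) = sum y (T k)"
      using T[OF k] k by (intro sum.cong) (auto simp: v_def subset_iff)
    then show ?thesis
      unfolding mult_mat_vec_upper_triangular_01[OF A v k] Tk using T[OF k] k by (simp add: v_def)
  qed
  have "A *\<^sub>v v = vec n (\<lambda>_. 1)"
  proof (rule eq_vecI)
    fix i assume "i < dim_vec (vec n (\<lambda>_. 1 :: real))"
    then show "(A *\<^sub>v v) $ i = vec n (\<lambda>_. 1) $ i"
      using Av[of "n - Suc i"] by simp
  qed (use A' in simp)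
  then have "entry_sum (mat_inv A) = sum y {..<n}"
    using entry_sum_mat_inv[OF A' v] by (simp add: v_def sum.nat_diff_reindex)
  with A that show ?thesis by blast
qed

theorem theorem2p1:
  fixes n :: nat and S :: real
  assumes "n \<ge> 3"
  shows "(\<exists>A \<in> upper_triangular_01 n. S = entry_sum (mat_inv A)) \<longleftrightarrow>
         S \<in> \<int> \<and> 2 - real (fib (n - 1)) \<le> S \<and> S \<le> 2 + real (fib (n - 1))"
proof
  assume "\<exists>A \<in> upper_triangular_01 n. S = entry_sum (mat_inv A)"
  then obtain y where y: "admissible n y" "S = sum y {..<n}"
    using entry_sum_mat_inv_admissible by metis
  have "S \<in> \<int>"
    unfolding y(2) using admissible_Ints[OF y(1)] by (intro Ints_sum) auto
  then show "S \<in> \<int> \<and> 2 - real (fib (n - 1)) \<le> S \<and> S \<le> 2 + real (fib (n - 1))"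
    using admissible_sum_bounds[OF y(1)] y(2) assms by simp
next
  assume S: "S \<in> \<int> \<and> 2 - real (fib (n - 1)) \<le> S \<and> S \<le> 2 + real (fib (n - 1))"
  then obtain s where s: "S = of_int s" by (auto elim: Ints_cases)
  have "2 - int (fib (n - 1)) \<le> s" "s \<le> 2 + int (fib (n - 1))"
    using S unfolding s by linarith+
  with assms obtain y where y: "admissible n y" "sum y {..<n} = s"
    by (rule admissible_sum_attained)
  \<comment> \<open>Attainment was argued over \<open>int\<close>, while the matrices are real; the
    same index sets serve after the cast.\<close>
  have "admissible n (\<lambda>k. real_of_int (y k))"
    unfolding admissible_def
  proof (intro allI impI)
    fix k assume "k < n"
    with y(1) obtain T where "T \<subseteq> {..<k}" "y k = 1 - sum y T"
      by (auto simp: admissible_def)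
    then show "\<exists>T\<subseteq>{..<k}. real_of_int (y k) = 1 - (\<Sum>k\<in>T. real_of_int (y k))"
      by (intro exI[of _ T]) simp
  qed
  then obtain A where "A \<in> upper_triangular_01 n"
    "entry_sum (mat_inv A) = (\<Sum>k<n. real_of_int (y k))"
    by (rule admissible_entry_sum_mat_inv)
  then show "\<exists>A \<in> upper_triangular_01 n. S = entry_sum (mat_inv A)"
    using s y(2) by (intro bexI[of _ A]) auto
qed

end
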